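(* The coordination capacity region for empirical coordination in the two-node network with source distribution $p_0(x)$ is $$\mathcal{C}_{p_0}=\{(R,p(y|x)) : R\ge I(X;Y)\},$$ where the mutual information is computed under $(X,Y)\sim p_0(x)p(y|x)$.
   Context: Alphabets $\mathcal{X},\mathcal{Y}$ are finite; rates are nonnegative reals measured in bits (logarithms base 2); $\{1,\dots,2^{nR}\}$ denotes the set of integers $k$ with $1\le k\le 2^{nR}$. Two-node network: a $(2^{nR},n)$ coordination code consists of an encoding function $i:\mathcal{X}^n\to\{1,\dots,2^{nR}\}$ and a decoding function $y^n:\{1,\dots,2^{nR}\}\to\mathcal{Y}^n$. The actions $X^n$ are i.i.d. according to $p_0(x)$, and $Y^n=y^n(i(X^n))$. The joint type is $P_{x^n,y^n}(x,y)=\frac1n\sum_{i=1}^n\mathbf{1}((x_i,y_i)=(x,y))$. Total variation is $\|p-q\|_{TV}=\frac12\sum|p-q|$. The distribution $p_0(x)p(y|x)$ is achievable for empirical coordination at rate $R$ if there exists a sequence of $(2^{nR},n)$ coordination codes ($n=1,2,\dots$) such that $\|P_{X^n,Y^n}-p_0(x)p(y|x)\|_{TV}\to0$ in probability. The coordination capacity region $\mathcal{C}_{p_0}$ is the closure of the set of pairs $(R,p(y|x))$ such that $p_0(x)p(y|x)$ is achievable at rate $R$. *)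

theory Defs
  imports "HOL-Probability.Probability"
begin

text \<open>Block length \<open>n\<close> sequences are extensional functions on \<open>{1..n}\<close>.\<close>

abbreviation seqs :: "nat \<Rightarrow> (nat \<Rightarrow> 'a) set" where
  "seqs n \<equiv> {1..n} \<rightarrow>\<^sub>E UNIV"

definition messages :: "real \<Rightarrow> nat \<Rightarrow> nat set" where
  "messages R n = {k. 1 \<le> k \<and> real k \<le> 2 powr (real n * R)}"

definition coordination_code ::
    "real \<Rightarrow> nat \<Rightarrow> ((nat \<Rightarrow> 'x) \<Rightarrow> nat) \<Rightarrow> (nat \<Rightarrow> (nat \<Rightarrow> 'y)) \<Rightarrow> bool" where
  "coordination_code R n enc dec \<longleftrightarrow>
     enc \<in> seqs n \<rightarrow> messages R n \<and> dec \<in> messages R n \<rightarrow> seqs n"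

definition iid_source :: "'x pmf \<Rightarrow> nat \<Rightarrow> (nat \<Rightarrow> 'x) pmf" where
  "iid_source p0 n = Pi_pmf {1..n} undefined (\<lambda>_. p0)"

definition joint_type :: "nat \<Rightarrow> (nat \<Rightarrow> 'x) \<Rightarrow> (nat \<Rightarrow> 'y) \<Rightarrow> 'x \<times> 'y \<Rightarrow> real" where
  "joint_type n xs ys z = 1 / real n * (\<Sum>i = 1..n. of_bool ((xs i, ys i) = z))"

definition tv_dist :: "('a::finite \<Rightarrow> real) \<Rightarrow> ('a \<Rightarrow> real) \<Rightarrow> real" where
  "tv_dist p q = 1 / 2 * (\<Sum>z\<in>UNIV. \<bar>p z - q z\<bar>)"

definition joint_pmf :: "'x pmf \<Rightarrow> ('x \<Rightarrow> 'y pmf) \<Rightarrow> ('x \<times> 'y) pmf" where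
  "joint_pmf p0 W = bind_pmf p0 (\<lambda>x. map_pmf (Pair x) (W x))"

lemma pmf_joint_pmf: "pmf (joint_pmf p0 W) (x, y) = pmf p0 x * pmf (W x) y"
proof -
  have "pmf (map_pmf (Pair x') (W x')) (x, y) = indicator {x} x' * pmf (W x) y" for x'
    by (cases "x' = x") (auto simp: pmf_map_inj' inj_on_def intro!: pmf_map_outside)
  then show ?thesis
    by (simp add: joint_pmf_def pmf_bind measure_pmf_single)
qed

text \<open>
  Convergence in probability to a constant involves only the law of each individual \<open>X\<^sup>n\<close>,
  so the sequences of different lengths need not live on one probability space.
\<close>

definition achievable ::
    "('x::finite) pmf \<Rightarrow> real \<Rightarrow> ('x \<Rightarrow> ('y::finite) pmf) \<Rightarrow> bool" where
  "achievable p0 R W \<longleftrightarrow>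
     (\<exists>enc dec.
        (\<forall>n\<ge>1. coordination_code R n (enc n) (dec n)) \<and>
        (\<forall>\<epsilon>>0. (\<lambda>n. measure_pmf.prob (iid_source p0 n)
            {xs. tv_dist (joint_type n xs (dec n (enc n xs))) (pmf (joint_pmf p0 W)) > \<epsilon>})
          \<longlonglongrightarrow> 0))"

text \<open>
  The type of pmfs carries no topology in the library. Pairs \<open>(R, p(y|x))\<close> get the usual
  Euclidean one, induced by reading \<open>p(y|x)\<close> as a real matrix.
\<close>

definition rate_kernel_topology ::
    "(real \<times> (('x::finite) \<Rightarrow> ('y::finite) pmf)) topology" where
  "rate_kernel_topology =
     pullback_topology UNIV (\<lambda>(R, W). (R, \<lambda>x y. pmf (W x) y)) euclidean"

definition coordination_capacity_region ::
    "('x::finite) pmf \<Rightarrow> (real \<times> ('x \<Rightarrow> ('y::finite) pmf)) set" where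
  "coordination_capacity_region p0 =
     rate_kernel_topology closure_of {(R, W). 0 \<le> R \<and> achievable p0 R W}"

definition mutual_info :: "('x \<times> 'y) pmf \<Rightarrow> real" where
  "mutual_info P = prob_space.mutual_information (measure_pmf P) 2
     (count_space UNIV) (count_space UNIV) fst snd"

end

theory Submission
  imports Defs "HOL-Real_Asymp.Real_Asymp"
begin

text \<open>
  Converse: let \<open>Q(x|y)\<close> be the reverse kernel of \<open>p\<^sub>0(x)p(y|x)\<close>. For a fixed codeword \<open>y\<^sup>n\<close>,
  the score \<open>f(x,y) = log (Q(x|y) / p\<^sub>0(x))\<close> has exponential moment at most 1 under \<open>p\<^sub>0\<close>, so by Markov's
  inequality a total score of \<open>nt\<close> has probability at most \<open>2\<^bsup>-nt\<^esup>\<close>. A joint type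
  close to the target forces a total score of about \<open>nI(X;Y)\<close>, and a union bound over the \<open>2\<^bsup>nR\<^esup>\<close>
  codewords gives \<open>R \<ge> I(X;Y)\<close>. Continuity of \<open>I\<close> makes the right-hand side closed.

  Achievability for \<open>R > I(X;Y)\<close>: draw the codewords i.i.d. from the output distribution \<open>q\<close>. Changing
  measure from \<open>q\<^sup>n\<close> to \<open>p(y\<^sup>n|x\<^sup>n)\<close> costs about \<open>2\<^bsup>-nI\<^esup>\<close> on sequences whose joint type is close to the
  target, so if these have conditional probability \<open>w\<close>, then all codewords fail with probability at most
  \<open>(1 - 2\<^bsup>-nI\<^esup>w)\<close> to the power \<open>2\<^bsup>nR\<^esup>\<close>, which is at most \<open>1 - w + exp(-2\<^bsup>n(R-I)\<^esup>)\<close> by convexity. The mean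
  of \<open>1 - w\<close> tends to 0 by the law of large numbers.
\<close>

section \<open>Mutual information\<close>

definition output_pmf :: "'x pmf \<Rightarrow> ('x \<Rightarrow> 'y pmf) \<Rightarrow> 'y pmf" where
  "output_pmf p0 W = bind_pmf p0 W"

lemma pmf_output_pmf:
  fixes p0 :: "('x::finite) pmf"
  shows "pmf (output_pmf p0 W) y = (\<Sum>x\<in>UNIV. pmf p0 x * pmf (W x) y)"
  unfolding output_pmf_def by (simp add: pmf_bind integral_measure_pmf[of UNIV])

lemma map_fst_joint_pmf: "map_pmf fst (joint_pmf p0 W) = p0"
  by (simp add: joint_pmf_def map_bind_pmf map_pmf_comp bind_return_pmf')

lemma map_snd_joint_pmf: "map_pmf snd (joint_pmf p0 W) = output_pmf p0 W"
  by (simp add: joint_pmf_def output_pmf_def map_bind_pmf map_pmf_comp)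

text \<open>Absolute continuity: on the support of the joint distribution the denominators q(y) of
  the log ratios are positive, so those logarithms can be split.\<close>

lemma pmf_output_pmf_pos:
  fixes p0 :: "('x::finite) pmf"
  assumes "pmf p0 x > 0" "pmf (W x) y > 0"
  shows "pmf (output_pmf p0 W) y > 0"
  unfolding pmf_output_pmf
  by (rule sum_pos2[of _ x]) (use assms in auto)

text \<open>The density formula has the ratio p0(x) p(y|x) / (p0(x) q(y)). Cancelling p0(x) is
  harmless, since where it is 0 the weight in front of the logarithm is 0 too.\<close>

lemma mutual_info_eq_sum:
  fixes p0 :: "('x::finite) pmf" and W :: "'x \<Rightarrow> ('y::finite) pmf"
  shows "mutual_info (joint_pmf p0 W) =
    (\<Sum>(x, y)\<in>UNIV. pmf p0 x * pmf (W x) y * log 2 (pmf (W x) y / pmf (output_pmf p0 W) y))"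
proof -
  interpret information_space "measure_pmf (joint_pmf p0 W)" 2
    by unfold_locales simp
  have [simp]: "count_space (UNIV :: 'x set) \<Otimes>\<^sub>M count_space (UNIV :: 'y set) = count_space UNIV"
    by (simp add: pair_measure_count_space)
  have distr: "distributed (measure_pmf (joint_pmf p0 W)) (count_space UNIV) f (pmf (map_pmf f (joint_pmf p0 W)))"
    for f :: "'x \<times> 'y \<Rightarrow> 'c"
    unfolding distributed_def
    by (simp add: map_pmf_rep_eq[symmetric] measure_pmf_eq_density[symmetric])
  have "mutual_info (joint_pmf p0 W) =
    (\<Sum>z\<in>UNIV. pmf (joint_pmf p0 W) z * log 2 (pmf (joint_pmf p0 W) z / (pmf p0 (fst z) * pmf (output_pmf p0 W) (snd z))))"
    unfolding mutual_info_def
    by (subst mutual_information_distr[where Px = "pmf p0" and Py = "pmf (output_pmf p0 W)" and Pxy = "pmf (joint_pmf p0 W)"])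
      (use distr[of fst] distr[of snd] distr[of "\<lambda>z. z"] in
        \<open>auto simp: sigma_finite_measure_count_space_finite map_fst_joint_pmf map_snd_joint_pmf pmf.map_ident
          lebesgue_integral_count_space_finite\<close>)
  also have "\<dots> = (\<Sum>(x, y)\<in>UNIV. pmf p0 x * pmf (W x) y * log 2 (pmf (W x) y / pmf (output_pmf p0 W) y))"
    by (rule sum.cong) (auto simp: pmf_joint_pmf)
  finally show ?thesis .
qed

text \<open>Gibbs' inequality: ln t \<le> t - 1 at t = q(y) / p(y|x) bounds each term below by p0(x)
  p(y|x) - p0(x) q(y), and these differences sum to 1 - 1 = 0. It guarantees that every rate above
  the mutual information is a legal, nonnegative rate.\<close>

lemma mutual_info_nonneg:
  fixes p0 :: "('x::finite) pmf" and W :: "'x \<Rightarrow> ('y::finite) pmf"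
  shows "mutual_info (joint_pmf p0 W) \<ge> 0"
proof -
  let ?q = "pmf (output_pmf p0 W)"
  have "(\<Sum>(x, y)\<in>UNIV. pmf p0 x * pmf (W x) y - pmf p0 x * ?q y)
      \<le> (\<Sum>(x, y)\<in>UNIV. pmf p0 x * pmf (W x) y * ln (pmf (W x) y / ?q y))"
  proof (rule sum_mono, clarify)
    fix x y
    show "pmf p0 x * pmf (W x) y - pmf p0 x * ?q y \<le> pmf p0 x * pmf (W x) y * ln (pmf (W x) y / ?q y)"
    proof (cases "pmf p0 x > 0 \<and> pmf (W x) y > 0")
      case True
      then have q: "?q y > 0"
        using pmf_output_pmf_pos by metis
      have "- ln (pmf (W x) y / ?q y) = ln (?q y / pmf (W x) y)"
        using True q by (simp add: ln_div)
      also have "\<dots> \<le> ?q y / pmf (W x) y - 1"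
        using True q by (intro ln_le_minus_one) simp
      finally have "pmf p0 x * pmf (W x) y * (1 - ?q y / pmf (W x) y)
          \<le> pmf p0 x * pmf (W x) y * ln (pmf (W x) y / ?q y)"
        by (intro mult_left_mono) auto
      then show ?thesis
        using True by (simp add: algebra_simps)
    next
      case False
      then have "pmf p0 x = 0 \<or> pmf (W x) y = 0"
        by (metis less_eq_real_def pmf_nonneg)
      then show ?thesis by auto
    qed
  qed
  moreover have "(\<Sum>(x, y)\<in>UNIV. pmf p0 x * pmf (W x) y - pmf p0 x * ?q y) = 0"
    by (simp add: UNIV_Times_UNIV[symmetric] sum.cartesian_product[symmetric] sum_subtractf
        sum_distrib_left[symmetric] sum_pmf_eq_1 del: UNIV_Times_UNIV)
  ultimately have "0 \<le> (\<Sum>(x, y)\<in>UNIV. pmf p0 x * pmf (W x) y * ln (pmf (W x) y / ?q y)) / ln 2"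
    by simp
  then show ?thesis
    by (simp add: mutual_info_eq_sum log_def sum_divide_distrib case_prod_unfold)
qed

section \<open>Continuity in the kernel and closedness of the region\<close>

text \<open>The truncation \<open>max 0\<close> makes the formula continuous on all real matrices, not just stochastic ones.\<close>

lemma mutual_info_eq_xlogx:
  fixes p0 :: "('x::finite) pmf" and W :: "'x \<Rightarrow> ('y::finite) pmf"
  defines "h \<equiv> \<lambda>t. max 0 t * log 2 (max 0 t)"
  shows "mutual_info (joint_pmf p0 W) =
    (\<Sum>x\<in>UNIV. \<Sum>y\<in>UNIV. pmf p0 x * h (pmf (W x) y)) -
    (\<Sum>y\<in>UNIV. h (\<Sum>x\<in>UNIV. pmf p0 x * pmf (W x) y))"
proof -
  let ?q = "pmf (output_pmf p0 W)"
  have "pmf p0 x * pmf (W x) y * log 2 (pmf (W x) y / ?q y)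
      = pmf p0 x * h (pmf (W x) y) - pmf p0 x * pmf (W x) y * log 2 (?q y)" for x y
  proof (cases "pmf p0 x > 0 \<and> pmf (W x) y > 0")
    case True
    then have "?q y > 0"
      using pmf_output_pmf_pos by metis
    then show ?thesis
      using True by (simp add: h_def log_divide algebra_simps)
  next
    case False
    then have "pmf p0 x = 0 \<or> pmf (W x) y = 0"
      by (metis less_eq_real_def pmf_nonneg)
    then show ?thesis by (auto simp: h_def)
  qed
  then have "mutual_info (joint_pmf p0 W) =
     (\<Sum>x\<in>UNIV. \<Sum>y\<in>UNIV. pmf p0 x * h (pmf (W x) y)) -
     (\<Sum>x\<in>UNIV. \<Sum>y\<in>UNIV. pmf p0 x * pmf (W x) y * log 2 (?q y))"
    unfolding mutual_info_eq_sum
    by (simp add: UNIV_Times_UNIV[symmetric] sum.cartesian_product[symmetric] sum_subtractf del: UNIV_Times_UNIV)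
  also have "(\<Sum>x\<in>UNIV. \<Sum>y\<in>UNIV. pmf p0 x * pmf (W x) y * log 2 (?q y)) = (\<Sum>y\<in>UNIV. h (?q y))"
    by (subst sum.swap) (simp add: h_def sum_distrib_right[symmetric] pmf_output_pmf[symmetric])
  finally show ?thesis
    by (simp add: pmf_output_pmf)
qed

text \<open>Only t = 0 needs care: the function is constantly 0 on the left, and t log t tends to 0
  from the right.\<close>

lemma continuous_on_xlogx: "continuous_on UNIV (\<lambda>t::real. max 0 t * log 2 (max 0 t))"
proof -
  have "isCont (\<lambda>t::real. max 0 t * log 2 (max 0 t)) t" for t :: real
  proof (cases t "0::real" rule: linorder_cases)
    case less
    have "isCont (\<lambda>t::real. max 0 t * log 2 (max 0 t)) t \<longleftrightarrow> isCont (\<lambda>t::real. 0::real) t"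
      by (rule isCont_cong) (use eventually_nhds_in_open[of "{..<0}" t] less in \<open>auto elim!: eventually_mono\<close>)
    then show ?thesis by simp
  next
    case equal
    have "((\<lambda>t::real. max 0 t * log 2 (max 0 t)) \<longlongrightarrow> 0) (at_left 0)"
      by (rule tendsto_eventually) (auto simp: eventually_at_left_field intro!: exI[of _ "-1"])
    moreover have "((\<lambda>t::real. t * log 2 t) \<longlongrightarrow> 0) (at_right 0)"
      by real_asymp
    then have "((\<lambda>t::real. max 0 t * log 2 (max 0 t)) \<longlongrightarrow> 0) (at_right 0)"
      by (rule Lim_transform_eventually) (auto simp: eventually_at_right_field intro!: exI[of _ 1])
    ultimately show ?thesis
      using equal by (simp add: isCont_def filterlim_at_split)
  next
    case greater
    have "isCont (\<lambda>t::real. max 0 t * log 2 (max 0 t)) t \<longleftrightarrow> isCont (\<lambda>t::real. t * log 2 t) t"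
      by (rule isCont_cong) (use eventually_nhds_in_open[of "{0<..}" t] greater in \<open>auto elim!: eventually_mono\<close>)
    moreover have "isCont (\<lambda>t::real. t * log 2 t) t"
      using greater by (auto intro!: continuous_intros)
    ultimately show ?thesis by simp
  qed
  then show ?thesis
    by (simp add: continuous_on_eq_continuous_at)
qed

lemma closedin_mutual_info_le:
  fixes p0 :: "('x::finite) pmf"
  shows "closedin rate_kernel_topology
    {(R, W :: 'x \<Rightarrow> ('y::finite) pmf). R \<ge> mutual_info (joint_pmf p0 W)}"
proof -
  let ?h = "\<lambda>t::real. max 0 t * log 2 (max 0 t)"
  \<comment> \<open>\<open>g\<close> extends R - I(X;Y) from stochastic matrices to all real ones.
    The topology is pulled back from the whole matrix space, so continuity is needed there; the
    region is then the preimage of the closed half-line of nonnegative reals.\<close>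
  define g :: "real \<times> ('x \<Rightarrow> 'y \<Rightarrow> real) \<Rightarrow> real" where
    "g = (\<lambda>z. fst z - ((\<Sum>x\<in>UNIV. \<Sum>y\<in>UNIV. pmf p0 x * ?h (snd z x y)) -
           (\<Sum>y\<in>UNIV. ?h (\<Sum>x\<in>UNIV. pmf p0 x * snd z x y))))"
  have coord: "continuous_on UNIV (\<lambda>z :: real \<times> ('x \<Rightarrow> 'y \<Rightarrow> real). snd z x y)" for x y
    by (rule continuous_on_product_then_coordinatewise,
        rule continuous_on_product_then_coordinatewise, rule continuous_on_snd, rule continuous_on_id)
  note h = continuous_on_compose2[OF continuous_on_xlogx]
  have "continuous_on UNIV g"
    unfolding g_def
    by (intro continuous_on_diff continuous_on_sum continuous_on_fst continuous_on_id continuous_on_mult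
        continuous_on_const h coord) auto
  then have "continuous_map rate_kernel_topology euclideanreal
      (g \<circ> (\<lambda>(R, W). (R, \<lambda>x (y::'y). pmf (W x) y)))"
    unfolding rate_kernel_topology_def
    by (intro continuous_map_pullback) auto
  from closedin_continuous_map_preimage[OF this, of "{0..}"]
  show ?thesis
    by (simp add: rate_kernel_topology_def topspace_pullback_topology g_def case_prod_unfold
        mutual_info_eq_xlogx)
qed

section \<open>Converse\<close>

lemma joint_type_score:
  fixes f :: "('x::finite) \<times> ('y::finite) \<Rightarrow> real"
  assumes "n \<ge> 1"
  shows "(\<Sum>i=1..n. f (xs i, ys i)) = real n * (\<Sum>z\<in>UNIV. joint_type n xs ys z * f z)"
proof -
  have "real n * (\<Sum>z\<in>UNIV. joint_type n xs ys z * f z)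
      = (\<Sum>z\<in>UNIV. \<Sum>i=1..n. of_bool ((xs i, ys i) = z) * f z)"
    using assms by (simp add: joint_type_def sum_distrib_left sum_distrib_right)
  also have "\<dots> = (\<Sum>i=1..n. \<Sum>z\<in>UNIV. of_bool ((xs i, ys i) = z) * f z)"
    by (rule sum.swap)
  also have "\<dots> = (\<Sum>i=1..n. f (xs i, ys i))"
    by (intro sum.cong refl) (simp add: of_bool_def if_distrib[of "\<lambda>t. t * _"] cong: if_cong)
  finally show ?thesis by simp
qed

lemma tv_dist_score:
  fixes f p q :: "'a::finite \<Rightarrow> real"
  assumes "\<And>z. \<bar>f z\<bar> \<le> B"
  shows "\<bar>(\<Sum>z\<in>UNIV. p z * f z) - (\<Sum>z\<in>UNIV. q z * f z)\<bar> \<le> 2 * tv_dist p q * B"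
proof -
  have "\<bar>(\<Sum>z\<in>UNIV. p z * f z) - (\<Sum>z\<in>UNIV. q z * f z)\<bar> = \<bar>\<Sum>z\<in>UNIV. (p z - q z) * f z\<bar>"
    by (simp add: sum_subtractf algebra_simps)
  also have "\<dots> \<le> (\<Sum>z\<in>UNIV. \<bar>p z - q z\<bar> * B)"
    by (rule order.trans[OF sum_abs]) (auto simp: abs_mult intro!: sum_mono mult_left_mono assms)
  also have "\<dots> = 2 * tv_dist p q * B"
    by (simp add: tv_dist_def sum_distrib_right)
  finally show ?thesis .
qed

text \<open>The bridge from closeness in type to total scores, which serves both halves: the
  converse uses the lower estimate of the score, achievability the upper one.\<close>

lemma tv_dist_joint_type_score:
  fixes f :: "('x::finite) \<times> ('y::finite) \<Rightarrow> real"
  assumes "n \<ge> 1" "\<And>z. \<bar>f z\<bar> \<le> B" "tv_dist (joint_type n xs ys) q \<le> \<epsilon>"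
  shows "\<bar>(\<Sum>i=1..n. f (xs i, ys i)) - real n * (\<Sum>z\<in>UNIV. q z * f z)\<bar> \<le> real n * (2 * \<epsilon> * B)"
proof -
  have B: "B \<ge> 0"
    using assms(2) abs_ge_zero order.trans by blast
  have "\<bar>(\<Sum>z\<in>UNIV. joint_type n xs ys z * f z) - (\<Sum>z\<in>UNIV. q z * f z)\<bar> \<le> 2 * tv_dist (joint_type n xs ys) q * B"
    by (rule tv_dist_score) fact
  also have "\<dots> \<le> 2 * \<epsilon> * B"
    using assms(3) B by (intro mult_right_mono) auto
  finally have "real n * \<bar>(\<Sum>z\<in>UNIV. joint_type n xs ys z * f z) - (\<Sum>z\<in>UNIV. q z * f z)\<bar> \<le> real n * (2 * \<epsilon> * B)"
    by (rule mult_left_mono) simp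
  then show ?thesis
    unfolding joint_type_score[OF assms(1)] right_diff_distrib[symmetric] abs_mult by simp
qed

section \<open>Supports of product distributions and sizes of message sets\<close>

lemma finite_set_Pi_pmf:
  assumes "finite A" "\<And>x. x \<in> A \<Longrightarrow> finite (set_pmf (p x))"
  shows "finite (set_pmf (Pi_pmf A d p))"
  unfolding set_Pi_pmf[OF assms(1)] by (rule finite_PiE_dflt) (use assms in simp_all)

lemma set_Pi_pmf_outside:
  assumes "finite A" "f \<in> set_pmf (Pi_pmf A d p)" "i \<notin> A"
  shows "f i = d"
  using subsetD[OF set_Pi_pmf_subset[OF assms(1)] assms(2)] assms(3) by simp

text \<open>A code constrains its encoder only on \<open>seqs n\<close>; the source never leaves
  that set. The same fact later places random codewords in \<open>seqs n\<close>.\<close>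

lemma set_iid_source: "set_pmf (iid_source p0 n) \<subseteq> seqs n"
proof
  fix xs assume "xs \<in> set_pmf (iid_source p0 n)"
  then have "xs i = undefined" if "i \<notin> {1..n}" for i
    using set_Pi_pmf_outside[OF finite_atLeastAtMost _ that] unfolding iid_source_def by metis
  then show "xs \<in> seqs n"
    by (intro PiE_I) blast+
qed

lemma finite_messages: "finite (messages R n)"
  and card_messages_le: "real (card (messages R n)) \<le> 2 powr (real n * R)"
  and card_messages_ge: "R \<ge> 0 \<Longrightarrow> real (card (messages R n)) \<ge> 2 powr (real n * R) / 2"
proof -
  let ?t = "2 powr (real n * R)"
  have eq: "messages R n = {1..nat \<lfloor>?t\<rfloor>}"
    unfolding messages_def by (auto simp: le_nat_iff le_floor_iff)
  then show "finite (messages R n)" "real (card (messages R n)) \<le> ?t"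
    by (auto simp: of_nat_nat)
  assume "R \<ge> 0"
  then have t: "?t \<ge> 1"
    by (simp add: ge_one_powr_ge_zero)
  then have "\<lfloor>?t\<rfloor> \<ge> 1"
    by (simp add: le_floor_iff)
  \<comment> \<open>Rounding down a number that is at least 1 loses less than half of it, whence the
    factor 2.\<close>
  moreover have "?t < real_of_int \<lfloor>?t\<rfloor> + 1"
    by linarith
  ultimately have "?t \<le> 2 * real_of_int \<lfloor>?t\<rfloor>"
    by linarith
  then show "real (card (messages R n)) \<ge> ?t / 2"
    unfolding eq using t by (simp add: of_nat_nat)
qed

section \<open>Exponential bound on the score that a code can reach\<close>

lemma prob_iid_source_score_le:
  fixes p0 :: "('x::finite) pmf" and f :: "'x \<times> 'y \<Rightarrow> real"
  assumes "\<And>y. (\<Sum>x\<in>UNIV. pmf p0 x * 2 powr f (x, y)) \<le> 1"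
  shows "measure_pmf.prob (iid_source p0 n) {xs. (\<Sum>i=1..n. f (xs i, ys i)) \<ge> t} \<le> 2 powr (-t)"
proof -
  let ?u = "\<lambda>xs. \<Prod>i\<in>{1..n}. 2 powr f (xs i, ys i)"
  have fin: "finite (set_pmf (iid_source p0 n))"
    unfolding iid_source_def by (intro finite_set_Pi_pmf) auto
  have "?u xs = 2 powr (\<Sum>i=1..n. f (xs i, ys i))" for xs
    by (simp add: powr_sum)
  then have "measure_pmf.prob (iid_source p0 n) {xs. (\<Sum>i=1..n. f (xs i, ys i)) \<ge> t}
      = measure_pmf.prob (iid_source p0 n) {xs \<in> space (iid_source p0 n). ?u xs \<ge> 2 powr t}"
    by simp
  also have "\<dots> \<le> measure_pmf.expectation (iid_source p0 n) ?u / 2 powr t"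
    by (intro integral_Markov_inequality_measure[where A = "{}"] integrable_measure_pmf_finite fin)
      (auto intro!: prod_nonneg)
  \<comment> \<open>For a fixed codeword \<open>ys\<close> the factors are independent, so the
    exponential moment is a product of one-letter moments, each at most 1.\<close>
  also have "measure_pmf.expectation (iid_source p0 n) ?u
      = (\<Prod>i\<in>{1..n}. measure_pmf.expectation p0 (\<lambda>x. 2 powr f (x, ys i)))"
    unfolding iid_source_def
    by (rule expectation_prod_Pi_pmf) (auto intro!: integrable_measure_pmf_finite)
  also have "\<dots> \<le> 1"
    by (rule prod_le_1) (use assms in \<open>auto simp: integral_measure_pmf[of UNIV] intro!: sum_nonneg\<close>)
  finally show ?thesis
    by (simp add: powr_minus_divide divide_right_mono)
qed

lemma prob_code_score_le:
  fixes p0 :: "('x::finite) pmf" and f :: "'x \<times> 'y \<Rightarrow> real"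
  assumes "\<And>y. (\<Sum>x\<in>UNIV. pmf p0 x * 2 powr f (x, y)) \<le> 1"
    and code: "coordination_code R n enc dec"
  shows "measure_pmf.prob (iid_source p0 n) {xs. (\<Sum>i=1..n. f (xs i, dec (enc xs) i)) \<ge> real n * c}
    \<le> 2 powr (real n * (R - c))"
proof -
  let ?S = "iid_source p0 n"
  have "measure_pmf.prob ?S {xs. (\<Sum>i=1..n. f (xs i, dec (enc xs) i)) \<ge> real n * c}
     \<le> measure_pmf.prob ?S (\<Union>m\<in>messages R n. {xs. (\<Sum>i=1..n. f (xs i, dec m i)) \<ge> real n * c})"
  \<comment> \<open>The inclusion is claimed only almost surely, because \<open>enc xs\<close> is
    known to be a message only for \<open>xs\<close> in \<open>seqs n\<close>.\<close>
  proof (rule measure_pmf.finite_measure_mono_AE)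
    have "enc xs \<in> messages R n" if "xs \<in> set_pmf ?S" for xs
      using code set_iid_source that unfolding coordination_code_def by blast
    then show "AE xs in ?S. xs \<in> {xs. (\<Sum>i=1..n. f (xs i, dec (enc xs) i)) \<ge> real n * c} \<longrightarrow>
        xs \<in> (\<Union>m\<in>messages R n. {xs. (\<Sum>i=1..n. f (xs i, dec m i)) \<ge> real n * c})"
      by (auto simp: AE_measure_pmf_iff)
  qed auto
  also have "\<dots> \<le> (\<Sum>m\<in>messages R n. measure_pmf.prob ?S {xs. (\<Sum>i=1..n. f (xs i, dec m i)) \<ge> real n * c})"
    by (rule measure_UNION_le) (auto simp: finite_messages)
  also have "\<dots> \<le> (\<Sum>m\<in>messages R n. 2 powr (- (real n * c)))"
    by (intro sum_mono prob_iid_source_score_le assms(1))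
  also have "\<dots> \<le> 2 powr (real n * R) * 2 powr (- (real n * c))"
    by (simp add: card_messages_le mult_right_mono)
  also have "\<dots> = 2 powr (real n * (R - c))"
    by (simp add: powr_add[symmetric] algebra_simps)
  finally show ?thesis .
qed

lemma finite_type_abs_bound:
  fixes f :: "'a::finite \<Rightarrow> real"
  obtains B where "B > 0" "\<And>z. \<bar>f z\<bar> \<le> B"
proof
  \<comment> \<open>The summand 1 keeps the bound positive even for f = 0, so that it can be divided
    by.\<close>
  show "1 + (\<Sum>z\<in>UNIV. \<bar>f z\<bar>) > 0"
    by (intro add_pos_nonneg sum_nonneg) auto
  show "\<bar>f z\<bar> \<le> 1 + (\<Sum>z\<in>UNIV. \<bar>f z\<bar>)" for z
    using member_le_sum[of z UNIV "\<lambda>z. \<bar>f z\<bar>"] by simp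
qed

text \<open>With probability tending to 1 the type is so close to the target that the total score is
  at least n(c - e), where c is the mean score. The union bound caps this probability at 2 to the
  power n(R - c + e), which would tend to 0 if c exceeded R + e.\<close>

lemma score_le_rate:
  fixes p0 :: "('x::finite) pmf" and W :: "'x \<Rightarrow> ('y::finite) pmf" and f :: "'x \<times> 'y \<Rightarrow> real"
  assumes ach: "achievable p0 R W"
    and f: "\<And>y. (\<Sum>x\<in>UNIV. pmf p0 x * 2 powr f (x, y)) \<le> 1"
  shows "(\<Sum>z\<in>UNIV. pmf (joint_pmf p0 W) z * f z) \<le> R"
proof (rule field_le_epsilon)
  fix e :: real assume e: "e > 0"
  define c where "c = (\<Sum>z\<in>UNIV. pmf (joint_pmf p0 W) z * f z)"
  obtain B where B: "B > 0" and fB: "\<And>z. \<bar>f z\<bar> \<le> B"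
    using finite_type_abs_bound[of f] by blast
  \<comment> \<open>Chosen so that a type within \<epsilon> of the target shifts the mean score by
    at most e.\<close>
  define \<epsilon> where "\<epsilon> = e / (2 * B)"
  have \<epsilon>: "\<epsilon> > 0" "2 * \<epsilon> * B = e" using e B by (auto simp: \<epsilon>_def)
  from ach obtain enc dec where code: "\<And>n. n \<ge> 1 \<Longrightarrow> coordination_code R n (enc n) (dec n)"
    and lim: "(\<lambda>n. measure_pmf.prob (iid_source p0 n)
            {xs. tv_dist (joint_type n xs (dec n (enc n xs))) (pmf (joint_pmf p0 W)) > \<epsilon>}) \<longlonglongrightarrow> 0"
    unfolding achievable_def using \<epsilon> by blast
  have bound: "1 - 2 powr (real n * (R - (c - e))) \<le> measure_pmf.prob (iid_source p0 n)
            {xs. tv_dist (joint_type n xs (dec n (enc n xs))) (pmf (joint_pmf p0 W)) > \<epsilon>}"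
    if n: "n \<ge> 1" for n
  proof -
    let ?A = "{xs. tv_dist (joint_type n xs (dec n (enc n xs))) (pmf (joint_pmf p0 W)) > \<epsilon>}"
    have "1 - measure_pmf.prob (iid_source p0 n) ?A = measure_pmf.prob (iid_source p0 n) (- ?A)"
      using measure_pmf.prob_compl[of ?A "iid_source p0 n"] by (simp add: Compl_eq_Diff_UNIV)
    also have "\<dots> \<le> measure_pmf.prob (iid_source p0 n)
        {xs. (\<Sum>i=1..n. f (xs i, dec n (enc n xs) i)) \<ge> real n * (c - e)}"
    proof (rule measure_pmf.finite_measure_mono)
      show "- ?A \<subseteq> {xs. (\<Sum>i=1..n. f (xs i, dec n (enc n xs) i)) \<ge> real n * (c - e)}"
      proof clarsimp
        fix xs
        assume "\<not> \<epsilon> < tv_dist (joint_type n xs (dec n (enc n xs))) (pmf (joint_pmf p0 W))"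
        then have "\<bar>(\<Sum>i=1..n. f (xs i, dec n (enc n xs) i)) - real n * c\<bar> \<le> real n * (2 * \<epsilon> * B)"
          unfolding c_def by (intro tv_dist_joint_type_score fB n) simp
        then have "real n * c - real n * e \<le> (\<Sum>i=1..n. f (xs i, dec n (enc n xs) i))"
          unfolding \<epsilon>(2) by linarith
        then show "real n * (c - e) \<le> (\<Sum>i = Suc 0..n. f (xs i, dec n (enc n xs) i))"
          by (simp add: right_diff_distrib)
      qed
    qed auto
    also have "\<dots> \<le> 2 powr (real n * (R - (c - e)))"
      by (rule prob_code_score_le[OF f code[OF n]])
    finally show ?thesis by linarith
  qed
  show "(\<Sum>z\<in>UNIV. pmf (joint_pmf p0 W) z * f z) \<le> R + e"
  proof (rule ccontr)
    assume "\<not> (\<Sum>z\<in>UNIV. pmf (joint_pmf p0 W) z * f z) \<le> R + e"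
    then have "R - (c - e) < 0" by (simp add: c_def)
    moreover have "(\<lambda>n. 1 - 2 powr (- real n * a)) \<longlonglongrightarrow> 1" if "a > 0" for a :: real
      using that by real_asymp
    from this[of "- (R - (c - e))"]
    have "R - (c - e) < 0 \<Longrightarrow> (\<lambda>n. 1 - 2 powr (real n * (R - (c - e)))) \<longlonglongrightarrow> 1"
      unfolding minus_mult_minus by simp
    ultimately have "(\<lambda>n. 1 - 2 powr (real n * (R - (c - e)))) \<longlonglongrightarrow> 1"
      by blast
    moreover have "\<forall>\<^sub>F n in sequentially. 1 - 2 powr (real n * (R - (c - e))) \<le> measure_pmf.prob (iid_source p0 n)
            {xs. tv_dist (joint_type n xs (dec n (enc n xs))) (pmf (joint_pmf p0 W)) > \<epsilon>}"
      using eventually_ge_at_top[of "1::nat"] by eventually_elim (rule bound)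
    ultimately have "(1::real) \<le> 0"
      using lim by (intro tendsto_le[OF sequentially_bot]) auto
    then show False by simp
  qed
qed

text \<open>By Bayes' rule Q(x|y) / p0(x) = p(y|x) / q(y), so the mean of the ideal score is the
  mutual information. That score is regularised at a cost of e bits, and e is arbitrary.\<close>

lemma achievable_imp_mutual_info_le:
  fixes p0 :: "('x::finite) pmf" and W :: "'x \<Rightarrow> ('y::finite) pmf"
  assumes "achievable p0 R W"
  shows "mutual_info (joint_pmf p0 W) \<le> R"
proof (rule field_le_epsilon)
  fix e :: real assume e: "e > 0"
  \<comment> \<open>With 1 - \<eta> = 2 powr (-e), the factor 1 - \<eta> inside the logarithm costs
    exactly e.\<close>
  define \<eta> :: real where "\<eta> = 1 - 2 powr (-e)"
  have \<eta>: "0 < \<eta>" "\<eta> < 1" "log 2 (1 - \<eta>) = - e"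
    using e powr_less_mono[of "-e" 0 2] by (auto simp: \<eta>_def)
  let ?q = "pmf (output_pmf p0 W)"
  \<comment> \<open>Mixing in weight \<open>\<eta>\<close> keeps the score finite where \<open>p(y|x) = 0\<close>.\<close>
  define f where "f = (\<lambda>(x, y). log 2 ((1 - \<eta>) * (pmf (W x) y / ?q y) + \<eta>))"
  have pos: "(1 - \<eta>) * (pmf (W x) y / ?q y) + \<eta> > 0" for x y
    using \<eta> by (intro add_nonneg_pos mult_nonneg_nonneg) auto
  have "(\<Sum>x\<in>UNIV. pmf p0 x * 2 powr f (x, y)) \<le> 1" for y
  proof -
    have "(\<Sum>x\<in>UNIV. pmf p0 x * 2 powr f (x, y))
        = (\<Sum>x\<in>UNIV. (1 - \<eta>) * (pmf p0 x * pmf (W x) y / ?q y) + \<eta> * pmf p0 x)"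
      using pos by (intro sum.cong refl) (simp add: f_def algebra_simps)
    \<comment> \<open>The quotient stays unsimplified because it is 0, not 1, for letters
      \<open>y\<close> of output probability 0; either way it is at most 1.\<close>
    also have "\<dots> = (1 - \<eta>) * (?q y / ?q y) + \<eta>"
      by (simp add: sum.distrib sum_distrib_left[symmetric] sum_divide_distrib[symmetric]
          pmf_output_pmf[symmetric] sum_pmf_eq_1)
    also have "\<dots> \<le> (1 - \<eta>) * 1 + \<eta>"
      using \<eta> by (intro add_right_mono mult_left_mono) auto
    finally show ?thesis by simp
  qed
  from score_le_rate[OF assms this]
  have score: "(\<Sum>z\<in>UNIV. pmf (joint_pmf p0 W) z * f z) \<le> R" .
  have "mutual_info (joint_pmf p0 W) - e
      = (\<Sum>(x, y)\<in>UNIV. pmf p0 x * pmf (W x) y * (log 2 (pmf (W x) y / ?q y) - e))"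
  proof -
    have "(\<Sum>(x, y)\<in>UNIV. pmf p0 x * pmf (W x) y * e) = (\<Sum>z\<in>UNIV. pmf (joint_pmf p0 W) z) * e"
      unfolding sum_distrib_right by (rule sum.cong) (auto simp: pmf_joint_pmf)
    also have "\<dots> = e"
      by (simp add: sum_pmf_eq_1)
    finally show ?thesis
      by (simp add: mutual_info_eq_sum case_prod_unfold right_diff_distrib sum_subtractf)
  qed
  also have "\<dots> \<le> (\<Sum>z\<in>UNIV. pmf (joint_pmf p0 W) z * f z)"
  proof (rule sum_mono, clarify)
    fix x y
    show "pmf p0 x * pmf (W x) y * (log 2 (pmf (W x) y / ?q y) - e) \<le> pmf (joint_pmf p0 W) (x, y) * f (x, y)"
    proof (cases "pmf p0 x > 0 \<and> pmf (W x) y > 0")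
      case True
      then have q: "?q y > 0"
        using pmf_output_pmf_pos by metis
      have "log 2 (pmf (W x) y / ?q y) - e = log 2 ((1 - \<eta>) * (pmf (W x) y / ?q y))"
        using True q \<eta> by (subst log_mult_pos) auto
      also have "\<dots> \<le> f (x, y)"
        using True q \<eta> pos[of x y] by (simp add: f_def)
      finally show ?thesis
        by (simp add: pmf_joint_pmf mult_left_mono)
    next
      case False
      then have "pmf p0 x = 0 \<or> pmf (W x) y = 0"
        by (metis less_eq_real_def pmf_nonneg)
      then show ?thesis by (auto simp: pmf_joint_pmf)
    qed
  qed
  finally show "mutual_info (joint_pmf p0 W) \<le> R + e"
    using score by linarith
qed

section \<open>Achievability\<close>

lemma prob_tv_dist_iid_type:
  fixes P :: "('x::finite \<times> 'y::finite) pmf"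
  assumes n: "n \<ge> 1" and \<epsilon>: "\<epsilon> \<ge> 0"
  defines "N \<equiv> real CARD('x \<times> 'y)"
  shows "measure_pmf.prob (Pi_pmf {1..n} d (\<lambda>_. P))
      {zs. tv_dist (joint_type n (fst \<circ> zs) (snd \<circ> zs)) (pmf P) > \<epsilon>}
    \<le> N * (2 * exp (-2 * real n * (2 * \<epsilon> / N)\<^sup>2))"
proof -
  have N: "N > 0" by (simp add: N_def)
  let ?Z = "Pi_pmf {1..n} d (\<lambda>_. P)"
  define T where "T = (\<lambda>zs :: nat \<Rightarrow> 'x \<times> 'y. joint_type n (fst \<circ> zs) (snd \<circ> zs))"
  have card: "T zs z = real (card {i\<in>{1..n}. zs i = z}) / real n" for zs z
    by (simp add: T_def joint_type_def of_bool_def sum.If_cases Int_def)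
  have single: "measure_pmf.prob ?Z {zs. \<bar>T zs z - pmf P z\<bar> \<ge> \<delta>} \<le> 2 * exp (-2 * real n * \<delta>\<^sup>2)"
    if "\<delta> \<ge> 0" for z \<delta>
  proof -
    interpret binomial_distribution n "pmf P z"
      by unfold_locales (simp add: pmf_le_1)
    \<comment> \<open>Being equal to \<open>z\<close> is a coin flip at each position, so the number
      of occurrences of \<open>z\<close> is binomial and Hoeffding's inequality applies.\<close>
    have coin: "map_pmf (\<lambda>z'. z' = z) P = bernoulli_pmf (pmf P z)"
    proof (rule pmf_eqI)
      fix b
      have "pmf (map_pmf (\<lambda>z'. z' = z) P) True = pmf P z"
        by (simp add: pmf_map vimage_def measure_pmf_single)
      moreover have "pmf (map_pmf (\<lambda>z'. z' = z) P) False = 1 - pmf P z"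
        using measure_pmf.prob_compl[of "{z}" P]
        by (simp add: pmf_map vimage_def measure_pmf_single Compl_eq_Diff_UNIV[symmetric] Collect_neg_eq)
      ultimately show "pmf (map_pmf (\<lambda>z'. z' = z) P) b = pmf (bernoulli_pmf (pmf P z)) b"
        by (cases b) (simp_all add: pmf_le_1)
    qed
    have "binomial_pmf n (pmf P z) = map_pmf (\<lambda>f. card {i\<in>{1..n}. f i})
        (Pi_pmf {1..n} (d = z) (\<lambda>_. bernoulli_pmf (pmf P z)))"
      by (rule binomial_pmf_altdef') (simp_all add: pmf_le_1)
    also have "Pi_pmf {1..n} (d = z) (\<lambda>_. bernoulli_pmf (pmf P z)) = map_pmf (\<lambda>zs. (\<lambda>z'. z' = z) \<circ> zs) ?Z"
      unfolding coin[symmetric] by (rule Pi_pmf_map) auto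
    finally have "binomial_pmf n (pmf P z) = map_pmf (\<lambda>zs. card {i\<in>{1..n}. zs i = z}) ?Z"
      by (simp add: map_pmf_comp o_def)
    then have "measure_pmf.prob ?Z {zs. \<bar>T zs z - pmf P z\<bar> \<ge> \<delta>}
        = measure_pmf.prob (binomial_pmf n (pmf P z)) {k. \<bar>real k / real n - pmf P z\<bar> \<ge> \<delta>}"
      by (simp add: card vimage_def)
    also have "\<dots> \<le> 2 * exp (-2 * real n * \<delta>\<^sup>2)"
      using prob_abs_ge'[of \<delta>] that n by simp
    finally show ?thesis .
  qed
  \<comment> \<open>If all N deviations are at most 2\<epsilon>/N, their sum is at most 2\<epsilon>
    and the total variation at most \<epsilon>.\<close>
  have "{zs. tv_dist (T zs) (pmf P) > \<epsilon>} \<subseteq> (\<Union>z\<in>UNIV. {zs. \<bar>T zs z - pmf P z\<bar> \<ge> 2 * \<epsilon> / N})"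
  proof (rule subsetI, rule ccontr)
    fix zs assume zs: "zs \<in> {zs. tv_dist (T zs) (pmf P) > \<epsilon>}"
      and "zs \<notin> (\<Union>z\<in>UNIV. {zs. \<bar>T zs z - pmf P z\<bar> \<ge> 2 * \<epsilon> / N})"
    then have "\<bar>T zs z - pmf P z\<bar> \<le> 2 * \<epsilon> / N" for z
      by (cases z) (auto simp: not_le intro: less_imp_le)
    then have "(\<Sum>z\<in>UNIV. \<bar>T zs z - pmf P z\<bar>) \<le> N * (2 * \<epsilon> / N)"
      unfolding N_def by (intro sum_bounded_above) auto
    then show False
      using zs N by (simp add: tv_dist_def)
  qed
  then have "measure_pmf.prob ?Z {zs. tv_dist (T zs) (pmf P) > \<epsilon>}
      \<le> measure_pmf.prob ?Z (\<Union>z\<in>UNIV. {zs. \<bar>T zs z - pmf P z\<bar> \<ge> 2 * \<epsilon> / N})"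
    by (intro measure_pmf.finite_measure_mono) auto
  also have "\<dots> \<le> (\<Sum>z\<in>UNIV. measure_pmf.prob ?Z {zs. \<bar>T zs z - pmf P z\<bar> \<ge> 2 * \<epsilon> / N})"
    by (rule measure_UNION_le) auto
  also have "\<dots> \<le> (\<Sum>z\<in>(UNIV :: ('x \<times> 'y) set). 2 * exp (-2 * real n * (2 * \<epsilon> / N)\<^sup>2))"
    by (intro sum_mono single) (use \<epsilon> N in auto)
  also have "\<dots> = N * (2 * exp (-2 * real n * (2 * \<epsilon> / N)\<^sup>2))"
    by (simp add: N_def)
  finally show ?thesis
    by (simp add: T_def)
qed

text \<open>Drawing i.i.d. pairs amounts to drawing the source sequence first and then passing it
  letter by letter through the channel.\<close>

lemma Pi_joint_pmf:
  assumes "finite A"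
  shows "map_pmf (\<lambda>zs. (fst \<circ> zs, snd \<circ> zs)) (Pi_pmf A (d, e) (\<lambda>_. joint_pmf p0 W)) =
    bind_pmf (Pi_pmf A d (\<lambda>_. p0)) (\<lambda>xs. map_pmf (Pair xs) (Pi_pmf A e (\<lambda>i. W (xs i))))"
proof -
  have "Pi_pmf A (d, e) (\<lambda>_. joint_pmf p0 W) =
      bind_pmf (Pi_pmf A d (\<lambda>_. p0)) (\<lambda>xs. Pi_pmf A (d, e) (\<lambda>i. map_pmf (Pair (xs i)) (W (xs i))))"
    unfolding joint_pmf_def by (rule Pi_pmf_bind[OF assms])
  also have "\<dots> = bind_pmf (Pi_pmf A d (\<lambda>_. p0)) (\<lambda>xs.
      map_pmf (\<lambda>ys i. (xs i, ys i)) (Pi_pmf A e (\<lambda>i. W (xs i))))"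
  proof (rule bind_pmf_cong[OF refl])
    fix xs assume "xs \<in> set_pmf (Pi_pmf A d (\<lambda>_. p0))"
    note xs = set_Pi_pmf_outside[OF assms this]
    show "Pi_pmf A (d, e) (\<lambda>i. map_pmf (Pair (xs i)) (W (xs i))) =
        map_pmf (\<lambda>ys i. (xs i, ys i)) (Pi_pmf A e (\<lambda>i. W (xs i)))"
    proof -
      have "Pi_pmf A (d, e) (\<lambda>i. map_pmf (Pair (xs i)) (W (xs i))) =
          bind_pmf (Pi_pmf A e (\<lambda>i. W (xs i)))
            (\<lambda>ys. return_pmf (\<lambda>i. if i \<in> A then (xs i, ys i) else (d, e)))"
        unfolding map_pmf_def by (subst Pi_pmf_bind[OF assms, of _ _ _ e]) (simp add: assms)
      also have "\<dots> = bind_pmf (Pi_pmf A e (\<lambda>i. W (xs i))) (\<lambda>ys. return_pmf (\<lambda>i. (xs i, ys i)))"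
      proof (rule bind_pmf_cong[OF refl])
        fix ys assume "ys \<in> set_pmf (Pi_pmf A e (\<lambda>i. W (xs i)))"
        note ys = set_Pi_pmf_outside[OF assms this]
        show "return_pmf (\<lambda>i. if i \<in> A then (xs i, ys i) else (d, e)) = return_pmf (\<lambda>i. (xs i, ys i))"
          by (rule arg_cong[of _ _ return_pmf]) (use xs ys in auto)
      qed
      finally show ?thesis
        by (simp add: map_pmf_def)
    qed
  qed
  finally show ?thesis
    by (simp add: map_bind_pmf map_pmf_comp o_def)
qed

section \<open>Random codebooks\<close>

lemma prob_eq_sum_of_bool:
  assumes "finite (set_pmf r)"
  shows "measure_pmf.prob r A = (\<Sum>a\<in>set_pmf r. pmf r a * of_bool (a \<in> A))"
proof -
  have "measure_pmf.prob r A = measure_pmf.expectation r (indicator A)"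
    by simp
  also have "\<dots> = (\<Sum>a\<in>set_pmf r. pmf r a * of_bool (a \<in> A))"
    using assms by (subst integral_measure_pmf[of "set_pmf r"]) (auto simp: indicator_def)
  finally show ?thesis .
qed

text \<open>Probabilistic method: for fixed \<open>x\<close>, independent codewords all miss
  \<open>G x\<close> with probability \<open>measure_pmf.prob q (- G x)\<close> to the power
  \<open>card M\<close>. Exchanging the sums shows that the right-hand side is the mean failure
  probability over codebooks, and some codebook in the support does no worse than the mean.\<close>

lemma random_codebook:
  assumes p: "finite (set_pmf p)" and q: "finite (set_pmf q)" and M: "finite M"
  obtains C where "\<And>m. m \<in> M \<Longrightarrow> C m \<in> set_pmf q"
    "measure_pmf.prob p {x. \<forall>m\<in>M. C m \<notin> G x} \<le>
       measure_pmf.expectation p (\<lambda>x. measure_pmf.prob q (- G x) ^ card M)"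
proof -
  define cb where "cb = Pi_pmf M undefined (\<lambda>_. q)"
  let ?E = "measure_pmf.expectation p (\<lambda>x. measure_pmf.prob q (- G x) ^ card M)"
  let ?F = "\<lambda>C. measure_pmf.prob p {x. \<forall>m\<in>M. C m \<notin> G x}"
  have fin: "finite (set_pmf cb)"
    unfolding cb_def using M q by (rule finite_set_Pi_pmf)
  have "(\<Sum>C\<in>set_pmf cb. pmf cb C * ?F C)
      = (\<Sum>C\<in>set_pmf cb. \<Sum>x\<in>set_pmf p. pmf cb C * (pmf p x * of_bool (\<forall>m\<in>M. C m \<notin> G x)))"
    by (simp add: prob_eq_sum_of_bool[OF p] sum_distrib_left)
  also have "\<dots> = (\<Sum>x\<in>set_pmf p. pmf p x * (\<Sum>C\<in>set_pmf cb. pmf cb C * of_bool (C \<in> Pi M (\<lambda>_. - G x))))"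
    by (subst sum.swap) (simp add: sum_distrib_left Pi_iff mult_ac)
  also have "\<dots> = (\<Sum>x\<in>set_pmf p. pmf p x * measure_pmf.prob cb (Pi M (\<lambda>_. - G x)))"
    by (simp only: prob_eq_sum_of_bool[OF fin])
  also have "\<dots> = (\<Sum>x\<in>set_pmf p. pmf p x * measure_pmf.prob q (- G x) ^ card M)"
    unfolding cb_def measure_Pi_pmf_Pi[OF M] by simp
  also have "\<dots> = ?E"
    by (subst integral_measure_pmf[OF p]) auto
  finally have avg: "(\<Sum>C\<in>set_pmf cb. pmf cb C * ?F C) = ?E" .
  have "\<exists>C\<in>set_pmf cb. ?F C \<le> ?E"
  proof (rule ccontr)
    assume "\<not> ?thesis"
    then have "(\<Sum>C\<in>set_pmf cb. pmf cb C * ?E) < (\<Sum>C\<in>set_pmf cb. pmf cb C * ?F C)"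
      by (intro sum_strict_mono fin set_pmf_not_empty mult_strict_left_mono) (auto simp: pmf_positive_iff)
    also have "(\<Sum>C\<in>set_pmf cb. pmf cb C * ?E) = ?E"
      using sum_pmf_eq_1[OF fin] by (simp add: sum_distrib_right[symmetric])
    finally show False
      using avg by simp
  qed
  then obtain C where C: "C \<in> set_pmf cb" "?F C \<le> ?E" by blast
  have "C m \<in> set_pmf q" if "m \<in> M" for m
    using C(1) that M by (auto simp: cb_def set_Pi_pmf PiE_dflt_def)
  with C(2) show thesis by (intro that)
qed

text \<open>In the application \<open>w\<close> is the conditional probability of a good output,
  \<open>c\<close> the change-of-measure factor and \<open>K\<close> the number of codewords. After
  1 - q \<le> exp(-q), convexity of exp between 0 and -cK pulls \<open>w\<close> out of the
  exponent.\<close>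

lemma one_minus_power_le:
  fixes c w q :: real
  assumes "0 \<le> w" "w \<le> 1" "c * w \<le> q" "q \<le> 1"
  shows "(1 - q) ^ K \<le> 1 - w + exp (- (c * real K))"
proof -
  have "(1 - q) ^ K \<le> exp (- q) ^ K"
    using assms exp_ge_add_one_self[of "- q"] by (intro power_mono) auto
  also have "\<dots> = exp (- (real K * q))"
    by (simp add: exp_of_nat_mult[symmetric])
  also have "\<dots> \<le> exp (- (real K * (c * w)))"
    using assms(3) by (simp add: mult_left_mono)
  also have "\<dots> = exp ((1 - w) *\<^sub>R 0 + w *\<^sub>R (- (c * real K)))"
    by (simp add: mult_ac)
  also have "\<dots> \<le> (1 - w) * exp 0 + w * exp (- (c * real K))"
    using assms by (intro convex_onD[OF exp_convex]) auto
  also have "\<dots> \<le> 1 - w + exp (- (c * real K))"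
    using assms mult_right_mono[of w 1 "exp (- (c * real K))"] by simp
  finally show ?thesis .
qed

section \<open>Change of measure between channel output and independent codewords\<close>

lemma prob_mono_scaled:
  assumes "finite (set_pmf r)" "\<And>y. y \<in> set_pmf r \<Longrightarrow> y \<in> A \<Longrightarrow> c * pmf r y \<le> pmf q y"
  shows "c * measure_pmf.prob r A \<le> measure_pmf.prob q A"
proof -
  have "c * measure_pmf.prob r A = c * measure_pmf.prob r (A \<inter> set_pmf r)"
    by (simp add: measure_Int_set_pmf)
  also have "\<dots> = (\<Sum>y\<in>A \<inter> set_pmf r. c * pmf r y)"
    using assms(1) by (simp add: measure_measure_pmf_finite sum_distrib_left)
  also have "\<dots> \<le> (\<Sum>y\<in>A \<inter> set_pmf r. pmf q y)"
    by (intro sum_mono assms(2)) auto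
  also have "\<dots> = measure_pmf.prob q (A \<inter> set_pmf r)"
    using assms(1) by (simp add: measure_measure_pmf_finite)
  also have "\<dots> \<le> measure_pmf.prob q A"
    by (intro measure_pmf.finite_measure_mono) auto
  finally show ?thesis .
qed

lemma set_Pi_pmf_component:
  assumes "finite A" "f \<in> set_pmf (Pi_pmf A d p)" "i \<in> A"
  shows "f i \<in> set_pmf (p i)"
  using assms set_Pi_pmf_subset'[of A d p] by (auto simp: PiE_dflt_def)

text \<open>The likelihood ratio of two product distributions is 2 to the power of the total
  score.\<close>

lemma powr_log_score_eq_prod:
  assumes "finite A" "\<And>i. i \<in> A \<Longrightarrow> a i > 0" "\<And>i. i \<in> A \<Longrightarrow> b i > (0::real)"
  shows "(\<Prod>i\<in>A. a i) = (\<Prod>i\<in>A. b i) * 2 powr (\<Sum>i\<in>A. log 2 (a i / b i))"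
proof -
  have "2 powr (\<Sum>i\<in>A. log 2 (a i / b i)) = (\<Prod>i\<in>A. a i / b i)"
    using assms by (subst powr_sum) (auto intro!: prod.cong)
  moreover have "(\<Prod>i\<in>A. b i) > 0"
    using assms by (intro prod_pos)
  ultimately show ?thesis
    by (simp add: prod_dividef)
qed

text \<open>On \<open>G\<close> the type is close to the target, under which the score has mean
  I(X;Y). The likelihood ratio of channel to output distribution is therefore at most 2 to the power
  n(I + 2\<epsilon>B), pointwise on the support of the channel output.\<close>

lemma prob_output_ge:
  fixes p0 :: "('x::finite) pmf" and W :: "'x \<Rightarrow> ('y::finite) pmf"
  assumes n: "n \<ge> 1" and xs: "xs \<in> set_pmf (iid_source p0 n)"
    and B: "\<And>z. \<bar>log 2 (pmf (W (fst z)) (snd z) / pmf (output_pmf p0 W) (snd z))\<bar> \<le> B"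
    and G: "\<And>ys. ys \<in> G \<Longrightarrow> tv_dist (joint_type n xs ys) (pmf (joint_pmf p0 W)) \<le> \<epsilon>"
  shows "2 powr (- (real n * (mutual_info (joint_pmf p0 W) + 2 * \<epsilon> * B))) *
      measure_pmf.prob (Pi_pmf {1..n} undefined (\<lambda>i. W (xs i))) G
    \<le> measure_pmf.prob (Pi_pmf {1..n} undefined (\<lambda>_. output_pmf p0 W)) G"
proof (rule prob_mono_scaled)
  show "finite (set_pmf (Pi_pmf {1..n} undefined (\<lambda>i. W (xs i))))"
    by (rule finite_set_Pi_pmf) auto
  fix ys assume ys: "ys \<in> set_pmf (Pi_pmf {1..n} undefined (\<lambda>i. W (xs i)))" and "ys \<in> G"
  let ?c = "real n * (mutual_info (joint_pmf p0 W) + 2 * \<epsilon> * B)"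
  define g where "g = (\<lambda>z. log 2 (pmf (W (fst z)) (snd z) / pmf (output_pmf p0 W) (snd z)))"
  have Wpos: "pmf (W (xs i)) (ys i) > 0" if "i \<in> {1..n}" for i
    using set_Pi_pmf_component[OF _ ys that] by (simp add: pmf_positive)
  have "pmf p0 (xs i) > 0" if "i \<in> {1..n}" for i
    using set_Pi_pmf_component[OF _ xs[unfolded iid_source_def] that] by (simp add: pmf_positive)
  then have qpos: "pmf (output_pmf p0 W) (ys i) > 0" if "i \<in> {1..n}" for i
    using Wpos that pmf_output_pmf_pos by metis
  note outside = set_Pi_pmf_outside[OF finite_atLeastAtMost ys]
  have "\<bar>(\<Sum>i=1..n. g (xs i, ys i)) - real n * (\<Sum>z\<in>UNIV. pmf (joint_pmf p0 W) z * g z)\<bar> \<le> real n * (2 * \<epsilon> * B)"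
    by (rule tv_dist_joint_type_score[OF n]) (use B G[OF \<open>ys \<in> G\<close>] in \<open>auto simp: g_def\<close>)
  moreover have "(\<Sum>z\<in>UNIV. pmf (joint_pmf p0 W) z * g z) = mutual_info (joint_pmf p0 W)"
    unfolding mutual_info_eq_sum by (rule sum.cong) (auto simp: pmf_joint_pmf g_def)
  ultimately have score: "(\<Sum>i=1..n. g (xs i, ys i)) \<le> ?c"
    by (simp add: distrib_left)
  have "pmf (Pi_pmf {1..n} undefined (\<lambda>i. W (xs i))) ys = (\<Prod>i\<in>{1..n}. pmf (W (xs i)) (ys i))"
    by (rule pmf_Pi') (use outside in auto)
  also have "\<dots> = (\<Prod>i\<in>{1..n}. pmf (output_pmf p0 W) (ys i)) * 2 powr (\<Sum>i=1..n. g (xs i, ys i))"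
    unfolding g_def fst_conv snd_conv by (rule powr_log_score_eq_prod) (use Wpos qpos in auto)
  also have "\<dots> \<le> (\<Prod>i\<in>{1..n}. pmf (output_pmf p0 W) (ys i)) * 2 powr ?c"
    using score by (intro mult_left_mono prod_nonneg) auto
  also have "(\<Prod>i\<in>{1..n}. pmf (output_pmf p0 W) (ys i)) = pmf (Pi_pmf {1..n} undefined (\<lambda>_. output_pmf p0 W)) ys"
    by (rule pmf_Pi'[symmetric]) (use outside in auto)
  finally have "2 powr (- ?c) * pmf (Pi_pmf {1..n} undefined (\<lambda>i. W (xs i))) ys
      \<le> 2 powr (- ?c) * (pmf (Pi_pmf {1..n} undefined (\<lambda>_. output_pmf p0 W)) ys * 2 powr ?c)"
    by (rule mult_left_mono) simp
  also have "\<dots> = pmf (Pi_pmf {1..n} undefined (\<lambda>_. output_pmf p0 W)) ys"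
    by (simp only: mult.left_commute[of "2 powr _"] powr_add[symmetric]) simp
  finally show "2 powr (- ?c) * pmf (Pi_pmf {1..n} undefined (\<lambda>i. W (xs i))) ys
      \<le> pmf (Pi_pmf {1..n} undefined (\<lambda>_. output_pmf p0 W)) ys" .
qed

text \<open>The tower rule: averaging over the source turns conditional failure probabilities into
  one probability for i.i.d. pairs, where the concentration bound applies.\<close>

lemma prob_conditional_tv_dist:
  fixes p0 :: "('x::finite) pmf" and W :: "'x \<Rightarrow> ('y::finite) pmf"
  shows "measure_pmf.expectation (iid_source p0 n) (\<lambda>xs.
      measure_pmf.prob (Pi_pmf {1..n} undefined (\<lambda>i. W (xs i))) {ys. Q xs ys})
    = measure_pmf.prob (Pi_pmf {1..n} (undefined, undefined) (\<lambda>_. joint_pmf p0 W))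
      {zs. Q (fst \<circ> zs) (snd \<circ> zs)}"
proof -
  let ?J = "bind_pmf (Pi_pmf {1..n} undefined (\<lambda>_. p0))
    (\<lambda>xs. map_pmf (Pair xs) (Pi_pmf {1..n} undefined (\<lambda>i. W (xs i))))"
  let ?S = "set_pmf (iid_source p0 n)"
  have fin: "finite ?S"
    unfolding iid_source_def by (rule finite_set_Pi_pmf) auto
  have finW: "finite (set_pmf (Pi_pmf {1..n} undefined (\<lambda>i. W (xs i))))" for xs
    by (rule finite_set_Pi_pmf) auto
  have "measure_pmf.prob (Pi_pmf {1..n} (undefined, undefined) (\<lambda>_. joint_pmf p0 W)) {zs. Q (fst \<circ> zs) (snd \<circ> zs)}
      = measure_pmf.prob ?J {(xs, ys). Q xs ys}"
    unfolding Pi_joint_pmf[OF finite_atLeastAtMost, symmetric] by (simp add: vimage_def)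
  also have "\<dots> = measure_pmf.expectation ?J (indicator {(xs, ys). Q xs ys})"
    by simp
  also have "\<dots> = (\<Sum>xs\<in>?S. pmf (iid_source p0 n) xs *\<^sub>R
      measure_pmf.expectation (map_pmf (Pair xs) (Pi_pmf {1..n} undefined (\<lambda>i. W (xs i)))) (indicator {(xs, ys). Q xs ys}))"
    using fin finW unfolding iid_source_def by (intro pmf_expectation_bind) auto
  also have "\<dots> = (\<Sum>xs\<in>?S. pmf (iid_source p0 n) xs *\<^sub>R
      measure_pmf.prob (Pi_pmf {1..n} undefined (\<lambda>i. W (xs i))) {ys. Q xs ys})"
    by (subst Bochner_Integration.integral_indicator) (simp_all add: vimage_def)
  also have "\<dots> = measure_pmf.expectation (iid_source p0 n) (\<lambda>xs.
      measure_pmf.prob (Pi_pmf {1..n} undefined (\<lambda>i. W (xs i))) {ys. Q xs ys})"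
    by (rule integral_measure_pmf[symmetric]) (use fin in auto)
  finally show ?thesis by simp
qed

text \<open>The first error term bounds the probability that the channel itself yields a bad type;
  the second accounts for a codebook that is too small.\<close>

lemma exists_coordination_code:
  fixes p0 :: "('x::finite) pmf" and W :: "'x \<Rightarrow> ('y::finite) pmf"
  assumes n: "n \<ge> 1" and R: "R \<ge> 0" and \<epsilon>: "\<epsilon> \<ge> 0"
    and B: "\<And>z. \<bar>log 2 (pmf (W (fst z)) (snd z) / pmf (output_pmf p0 W) (snd z))\<bar> \<le> B"
  defines "N \<equiv> real CARD('x \<times> 'y)"
  shows "\<exists>enc dec. coordination_code R n enc dec \<and>
    measure_pmf.prob (iid_source p0 n)
      {xs. tv_dist (joint_type n xs (dec (enc xs))) (pmf (joint_pmf p0 W)) > \<epsilon>}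
    \<le> N * (2 * exp (-2 * real n * (2 * \<epsilon> / N)\<^sup>2)) +
      exp (- (2 powr (real n * (R - mutual_info (joint_pmf p0 W) - 2 * \<epsilon> * B)) / 2))"
proof -
  let ?I = "mutual_info (joint_pmf p0 W)"
  let ?S = "iid_source p0 n"
  let ?M = "messages R n"
  define q where "q = Pi_pmf {1..n} undefined (\<lambda>_. output_pmf p0 W)"
  define V where "V = (\<lambda>xs. Pi_pmf {1..n} undefined (\<lambda>i. W (xs i)))"
  define G where "G = (\<lambda>xs. {ys. tv_dist (joint_type n xs ys) (pmf (joint_pmf p0 W)) \<le> \<epsilon>})"
  define c where "c = 2 powr (- (real n * (?I + 2 * \<epsilon> * B)))"
  define K where "K = card ?M"
  have finS: "finite (set_pmf ?S)"
    unfolding iid_source_def by (rule finite_set_Pi_pmf) auto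
  have finq: "finite (set_pmf q)"
    unfolding q_def by (rule finite_set_Pi_pmf) auto
  obtain C where C: "\<And>m. m \<in> ?M \<Longrightarrow> C m \<in> set_pmf q"
    and fail: "measure_pmf.prob ?S {xs. \<forall>m\<in>?M. C m \<notin> G xs}
      \<le> measure_pmf.expectation ?S (\<lambda>xs. measure_pmf.prob q (- G xs) ^ K)"
    unfolding K_def using random_codebook[OF finS finq finite_messages] by blast
  have compl: "measure_pmf.prob r (- A) = 1 - measure_pmf.prob r A" for r :: "'c pmf" and A
    using measure_pmf.prob_compl[of A r] by (simp add: Compl_eq_Diff_UNIV)
  have "measure_pmf.expectation ?S (\<lambda>xs. measure_pmf.prob q (- G xs) ^ K)
      \<le> measure_pmf.expectation ?S (\<lambda>xs. measure_pmf.prob (V xs) (- G xs) + exp (- (c * real K)))"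
  proof (rule integral_mono_AE)
    show "AE xs in ?S. measure_pmf.prob q (- G xs) ^ K \<le> measure_pmf.prob (V xs) (- G xs) + exp (- (c * real K))"
    proof (subst AE_measure_pmf_iff, rule ballI)
      fix xs assume xs: "xs \<in> set_pmf ?S"
      have "c * measure_pmf.prob (V xs) (G xs) \<le> measure_pmf.prob q (G xs)"
        unfolding c_def V_def q_def by (rule prob_output_ge[OF n xs B]) (simp add: G_def)
      then show "measure_pmf.prob q (- G xs) ^ K \<le> measure_pmf.prob (V xs) (- G xs) + exp (- (c * real K))"
        unfolding compl by (intro one_minus_power_le) auto
    qed
  qed (use finS in \<open>auto intro: integrable_measure_pmf_finite\<close>)
  also have "\<dots> = measure_pmf.expectation ?S (\<lambda>xs. measure_pmf.prob (V xs) (- G xs)) + exp (- (c * real K))"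
    by (subst Bochner_Integration.integral_add) (use finS in \<open>auto intro: integrable_measure_pmf_finite\<close>)
  also have "measure_pmf.expectation ?S (\<lambda>xs. measure_pmf.prob (V xs) (- G xs)) =
      measure_pmf.prob (Pi_pmf {1..n} (undefined, undefined) (\<lambda>_. joint_pmf p0 W))
      {zs. tv_dist (joint_type n (fst \<circ> zs) (snd \<circ> zs)) (pmf (joint_pmf p0 W)) > \<epsilon>}"
    unfolding V_def G_def Collect_neg_eq[symmetric] not_le by (rule prob_conditional_tv_dist)
  also have "\<dots> \<le> N * (2 * exp (-2 * real n * (2 * \<epsilon> / N)\<^sup>2))"
    unfolding N_def by (rule prob_tv_dist_iid_type[OF n \<epsilon>])
  finally have bound: "measure_pmf.expectation ?S (\<lambda>xs. measure_pmf.prob q (- G xs) ^ K)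
      \<le> N * (2 * exp (-2 * real n * (2 * \<epsilon> / N)\<^sup>2)) + exp (- (c * real K))"
    by simp
  \<comment> \<open>The exponent cK compares the number of codewords with the change-of-measure
    cost; the 1/2 comes from rounding the number of messages down.\<close>
  have "2 powr (real n * (R - ?I - 2 * \<epsilon> * B)) / 2 = c * (2 powr (real n * R) / 2)"
    by (simp add: c_def powr_add[symmetric] algebra_simps)
  also have "\<dots> \<le> c * real K"
    unfolding K_def by (intro mult_left_mono card_messages_ge R) (simp add: c_def)
  finally have "exp (- (c * real K)) \<le> exp (- (2 powr (real n * (R - ?I - 2 * \<epsilon> * B)) / 2))"
    by simp
  with fail bound have total: "measure_pmf.prob ?S {xs. \<forall>m\<in>?M. C m \<notin> G xs}
      \<le> N * (2 * exp (-2 * real n * (2 * \<epsilon> / N)\<^sup>2)) + exp (- (2 powr (real n * (R - ?I - 2 * \<epsilon> * B)) / 2))"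
    by linarith
  \<comment> \<open>The encoder sends any message whose codeword fits the source sequence. The
    fallback 1 is a message because R \<ge> 0.\<close>
  define enc where "enc = (\<lambda>xs. if \<exists>m\<in>?M. C m \<in> G xs then SOME m. m \<in> ?M \<and> C m \<in> G xs else 1)"
  have one: "1 \<in> ?M"
    using R by (simp add: messages_def ge_one_powr_ge_zero)
  have enc: "enc xs \<in> ?M \<and> ((\<exists>m\<in>?M. C m \<in> G xs) \<longrightarrow> C (enc xs) \<in> G xs)" for xs
  proof (cases "\<exists>m\<in>?M. C m \<in> G xs")
    case True
    then show ?thesis
      unfolding enc_def using someI_ex[of "\<lambda>m. m \<in> ?M \<and> C m \<in> G xs"] by auto
  qed (use one in \<open>simp add: enc_def\<close>)
  have "set_pmf q \<subseteq> seqs n"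
    using set_iid_source[of "output_pmf p0 W" n] by (simp add: q_def iid_source_def)
  then have code: "coordination_code R n enc C"
    unfolding coordination_code_def using enc C by blast
  have "measure_pmf.prob ?S {xs. tv_dist (joint_type n xs (C (enc xs))) (pmf (joint_pmf p0 W)) > \<epsilon>}
      \<le> measure_pmf.prob ?S {xs. \<forall>m\<in>?M. C m \<notin> G xs}"
  proof (rule measure_pmf.finite_measure_mono)
    show "{xs. tv_dist (joint_type n xs (C (enc xs))) (pmf (joint_pmf p0 W)) > \<epsilon>} \<subseteq> {xs. \<forall>m\<in>?M. C m \<notin> G xs}"
    proof (rule subsetI, rule ccontr)
      fix xs assume "xs \<in> {xs. tv_dist (joint_type n xs (C (enc xs))) (pmf (joint_pmf p0 W)) > \<epsilon>}"
        and "xs \<notin> {xs. \<forall>m\<in>?M. C m \<notin> G xs}"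
      then show False
        using enc[of xs] by (auto simp: G_def)
    qed
  qed auto
  with total code show ?thesis
    by (intro exI[of _ enc] exI[of _ C]) linarith
qed

text \<open>One sequence of codes has to serve every \<epsilon>, so the code of length n is built
  for its own tolerance \<open>\<delta> n\<close>, which eventually drops below any given
  \<epsilon>.\<close>

lemma achievable_if_mutual_info_less:
  fixes p0 :: "('x::finite) pmf" and W :: "'x \<Rightarrow> ('y::finite) pmf"
  assumes "mutual_info (joint_pmf p0 W) < R"
  shows "achievable p0 R W"
proof -
  let ?I = "mutual_info (joint_pmf p0 W)"
  define N where "N = real CARD('x \<times> 'y)"
  have N: "N > 0" by (simp add: N_def)
  define d where "d = R - ?I"
  have d: "d > 0" using assms by (simp add: d_def)
  have R: "R \<ge> 0"
    using assms mutual_info_nonneg[of p0 W] by linarith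
  obtain B where "B > 0" and B: "\<And>z. \<bar>log 2 (pmf (W (fst z)) (snd z) / pmf (output_pmf p0 W) (snd z))\<bar> \<le> B"
    using finite_type_abs_bound[of "\<lambda>z. log 2 (pmf (W (fst z)) (snd z) / pmf (output_pmf p0 W) (snd z))"] by blast
  \<comment> \<open>A tolerance that vanishes, but slowly enough for Hoeffding's bound to tend to 0.\<close>
  define \<delta> :: "nat \<Rightarrow> real" where "\<delta> = (\<lambda>n. real n powr (-1/4))"
  define F where "F = (\<lambda>n. N * (2 * exp (-2 * real n * (2 * \<delta> n / N)\<^sup>2)) +
      exp (- (2 powr (real n * (d - 2 * \<delta> n * B)) / 2)))"
  define good where "good = (\<lambda>n enc dec. coordination_code R n enc dec \<and>
      measure_pmf.prob (iid_source p0 n)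
        {xs. tv_dist (joint_type n xs (dec (enc xs))) (pmf (joint_pmf p0 W)) > \<delta> n} \<le> F n)"
  have "\<exists>enc dec. good n enc dec" if "n \<ge> 1" for n
    unfolding good_def using exists_coordination_code[OF that R _ B, of "\<delta> n"]
    by (simp add: F_def N_def d_def \<delta>_def)
  then obtain enc dec where "\<And>n. n \<ge> 1 \<Longrightarrow> good n (enc n) (dec n)"
    by metis
  then have code: "\<And>n. n \<ge> 1 \<Longrightarrow> coordination_code R n (enc n) (dec n)"
    and fail: "\<And>n. n \<ge> 1 \<Longrightarrow> measure_pmf.prob (iid_source p0 n)
        {xs. tv_dist (joint_type n xs (dec n (enc n xs))) (pmf (joint_pmf p0 W)) > \<delta> n} \<le> F n"
    unfolding good_def by blast+
  \<comment> \<open>Since n times the square of \<open>\<delta> n\<close> is the square root of n,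
    Hoeffding's exponent still diverges.\<close>
  have "(\<lambda>n. N * (2 * exp (-2 * real n * (2 * \<delta> n / N)\<^sup>2))) \<longlonglongrightarrow> 0"
    unfolding \<delta>_def using N by real_asymp
  \<comment> \<open>As \<open>\<delta> n\<close> vanishes, the rate gap \<open>d\<close> eventually
    dominates \<open>2 * \<delta> n * B\<close>, and the decay is doubly exponential.\<close>
  moreover have "(\<lambda>n. exp (- (2 powr (real n * (d - 2 * \<delta> n * B)) / 2))) \<longlonglongrightarrow> 0"
    unfolding \<delta>_def using d \<open>B > 0\<close> by real_asymp
  ultimately have F: "F \<longlonglongrightarrow> 0"
    unfolding F_def by (auto intro: tendsto_add_zero)
  show ?thesis
    unfolding achievable_def
  proof (intro exI[of _ enc] exI[of _ dec] conjI allI impI)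
    fix \<epsilon> :: real assume "\<epsilon> > 0"
    have "\<delta> \<longlonglongrightarrow> 0"
      unfolding \<delta>_def by real_asymp
    then have "\<forall>\<^sub>F n in sequentially. \<delta> n < \<epsilon>"
      using \<open>\<epsilon> > 0\<close> by (rule order_tendstoD)
    then have upper: "\<forall>\<^sub>F n in sequentially. measure_pmf.prob (iid_source p0 n)
        {xs. tv_dist (joint_type n xs (dec n (enc n xs))) (pmf (joint_pmf p0 W)) > \<epsilon>} \<le> F n"
      using eventually_ge_at_top[of 1]
    proof eventually_elim
      case (elim n)
      then show ?case
        by (intro order.trans[OF measure_pmf.finite_measure_mono fail]) auto
    qed
    show "(\<lambda>n. measure_pmf.prob (iid_source p0 n)
        {xs. tv_dist (joint_type n xs (dec n (enc n xs))) (pmf (joint_pmf p0 W)) > \<epsilon>}) \<longlonglongrightarrow> 0"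
      by (rule tendsto_sandwich[OF _ upper tendsto_const F]) auto
  qed (use code in auto)
qed

section \<open>The capacity region\<close>

theorem theorem3:
  fixes p0 :: "('x::finite) pmf"
  shows "(coordination_capacity_region p0 :: (real \<times> ('x \<Rightarrow> ('y::finite) pmf)) set) =
           {(R, W). R \<ge> mutual_info (joint_pmf p0 W)}"
proof
  show "coordination_capacity_region p0 \<subseteq> {(R, W :: 'x \<Rightarrow> 'y pmf). R \<ge> mutual_info (joint_pmf p0 W)}"
    unfolding coordination_capacity_region_def
    by (rule closure_of_minimal[OF _ closedin_mutual_info_le]) (auto intro: achievable_imp_mutual_info_le)
  show "{(R, W :: 'x \<Rightarrow> 'y pmf). R \<ge> mutual_info (joint_pmf p0 W)} \<subseteq> coordination_capacity_region p0"
  proof clarify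
    fix R and W :: "'x \<Rightarrow> 'y pmf" assume R: "mutual_info (joint_pmf p0 W) \<le> R"
    \<comment> \<open>The boundary R = I(X;Y) is reached only through the closure: the kernel stays
      fixed and the rate is raised slightly, so that it lies strictly above the mutual
      information.\<close>
    have "\<exists>r. 0 \<le> r \<and> achievable p0 r W \<and> (r, W) \<in> T"
      if T: "openin rate_kernel_topology T" "(R, W) \<in> T" for T
    proof -
      from T(1) obtain U where U: "open U" "T = (\<lambda>(R, W). (R, \<lambda>x y. pmf (W x) y)) -` U"
        unfolding rate_kernel_topology_def openin_pullback_topology by auto
      let ?V = "\<lambda>x y. pmf (W x) y"
      have "((\<lambda>r. (r, ?V)) \<longlongrightarrow> (R, ?V)) (at_right R)"
        by (intro tendsto_intros)
      then have "\<forall>\<^sub>F r in at_right R. (r, ?V) \<in> U"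
        by (rule topological_tendstoD) (use U T(2) in auto)
      then have "\<forall>\<^sub>F r in at_right R. r > R \<and> (r, ?V) \<in> U"
        using eventually_at_right_less[of R] by eventually_elim auto
      then obtain r where "r > R" "(r, ?V) \<in> U"
        using eventually_happens'[OF trivial_limit_at_right_real] by blast
      then show ?thesis
        using U R achievable_if_mutual_info_less[of p0 W r] mutual_info_nonneg[of p0 W]
        by (intro exI[of _ r]) auto
    qed
    then show "(R, W) \<in> coordination_capacity_region p0"
      unfolding coordination_capacity_region_def in_closure_of
      by (fastforce simp: rate_kernel_topology_def topspace_pullback_topology)
  qed
qed

end
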